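(* Let $\alpha,\gamma\in\mathbb{C}$ with $\gamma\neq 0,-1,-2,\cdots$, and let ${}_{1}F_{1}(\alpha;\gamma;z)$ be the confluent hypergeometric function, with derivative ${}_{1}F_{1}'(\alpha;\gamma;z)$ with respect to $z$. Then there is a set $E\subset\mathbb{R}_{+}$ of finite logarithmic measure such that $$m\left(r,\frac{{}_{1}F_{1}'(\alpha;\gamma;z)}{{}_{1}F_{1}(\alpha;\gamma;z)}\right)=O(1)$$ as $r\to\infty$, $r\notin E$.
   Context: For $\alpha,\gamma\in\mathbb{C}$ with $\gamma\neq 0,-1,-2,\cdots$, the confluent hypergeometric (Kummer) function is the entire function of $z$ given by ${}_{1}F_{1}(\alpha;\gamma;z):=\sum_{n=0}^{\infty}\frac{(\alpha)_{n}}{n!(\gamma)_{n}}z^{n}$, where $(\alpha)_0=1$ and $(\alpha)_{n}=\alpha(\alpha+1)\cdots(\alpha+n-1)$. For a meromorphic function $f$ in $\mathbb{C}$, the proximity function is $m(r,f)=\frac{1}{2\pi}\int_{0}^{2\pi}\log^{+}|f(re^{i\theta})|\,d\theta$, where $\log^{+}x=\max\{\log x,0\}$ (with $\log^{+}0=0$). A set $E\subset\mathbb{R}_{+}$ has finite logarithmic measure if $\int_{E}\frac{dt}{t}<+\infty$. *)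

theory Defs
  imports "HOL-Analysis.Analysis"
begin

text \<open>The series converges for all \<open>z\<close> when \<open>\<gamma>\<close> is not a non-positive integer.\<close>

definition kummer :: "complex \<Rightarrow> complex \<Rightarrow> complex \<Rightarrow> complex" where
  "kummer \<alpha> \<gamma> z = (\<Sum>n. pochhammer \<alpha> n / (fact n * pochhammer \<gamma> n) * z ^ n)"

definition log_plus :: "real \<Rightarrow> real" where
  "log_plus x = (if x = 0 then 0 else max (ln x) 0)"

text \<open>The integrand is non-negative, so the integral is taken in \<open>[0, \<infinity>]\<close>; a finite bound on
  the proximity function then cannot come from a default value of a non-existing integral.
  A meromorphic function has finitely many poles on each circle, so the values that \<open>f\<close> takes
  there (such as \<open>x / 0 = 0\<close>) do not affect the integral.\<close>

definition proximity :: "real \<Rightarrow> (complex \<Rightarrow> complex) \<Rightarrow> ennreal" where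
  "proximity r f = ennreal (1 / (2 * pi)) *
     (\<integral>\<^sup>+\<theta>\<in>{0..2 * pi}. ennreal (log_plus (norm (f (of_real r * cis \<theta>)))) \<partial>lborel)"

definition finite_log_measure :: "real set \<Rightarrow> bool" where
  "finite_log_measure E \<longleftrightarrow>
     E \<in> sets lebesgue \<and> (\<integral>\<^sup>+t\<in>E. ennreal (1 / t) \<partial>lebesgue) < \<infinity>"

end

theory Submission
  imports Defs "HOL-Complex_Analysis.Conformal_Mappings"
begin

text \<open>
  The usual lemma on the logarithmic derivative only gives \<open>O(log r)\<close> for functions of finite
  order. The sharper bound \<open>O(1)\<close> holds for every entire \<open>f\<close> with \<open>f 0 = 1\<close> and
  \<open>\<bar>f z\<bar> \<le> exp (B \<bar>z\<bar>)\<close>, on every circle that carries no zero of \<open>f\<close>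
  (\<open>proximity_log_deriv_exponential_type\<close>). The Kummer function is of this kind, because the
  ratios \<open>(\<alpha> + k) / (\<gamma> + k)\<close> of successive Pochhammer quotients are bounded
  (\<open>kummer_exponential_type\<close>). The exceptional set is the set of moduli of zeros; it is
  countable, so it even has logarithmic measure zero.

  To bound the mean of \<open>log\<^sup>+ \<bar>f'/f\<bar>\<close> over the circle \<open>\<bar>z\<bar> = r\<close>, use \<open>log\<^sup>+ x \<le> 2 \<surd>x\<close>
  and bound the mean of \<open>\<surd>\<bar>f'/f\<bar>\<close> instead. In the disc \<open>\<bar>z\<bar> \<le> 2 r\<close> write
  \<open>f z = (\<Prod> 1 - z / a) * g z\<close> with \<open>g\<close> free of zeros there. Comparing with the growth of \<open>f\<close> on
  \<open>\<bar>z\<bar> = 8 r\<close> shows that there are at most \<open>8 B r\<close> factors and that \<open>\<bar>g\<bar> \<le> exp (8 B r)\<close>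
  (\<open>disc_factorization\<close>). Then \<open>f'/f = (\<Sum> 1 / (z - a)) + g'/g\<close>. The second summand is
  bounded uniformly in \<open>r\<close> by applying the Borel-Caratheodory inequality to \<open>log g\<close>
  (\<open>log_deriv_zero_free_bound\<close>).

  The first summand has \<open>O(r)\<close> terms whose poles may lie arbitrarily close to the circle.
  The mean of its modulus admits no uniform bound, but the mean of the square root of its modulus
  does, by Kolmogorov's inequality for the conjugate function. Indeed, if all \<open>n\<close> points \<open>a\<close> lie outside the circle,
  then \<open>G z = (\<Sum> (a + z) / (a - z))\<close> has positive real part in the disc and \<open>G 0 = n\<close>. The
  principal root of \<open>G\<close> is then holomorphic with argument below \<open>\<pi>/4\<close>, so the mean of
  \<open>\<surd>\<bar>G\<bar>\<close> is at most \<open>\<surd>2\<close> times the mean of \<open>Re \<surd>G\<close>, which is \<open>\<surd>n\<close> by the mean value property.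
  Since \<open>\<Sum> 1 / (z - a) = (n - G z) / (2 z)\<close>, the mean of \<open>\<surd>\<bar>\<Sum> 1 / (z - a)\<bar>\<close> is \<open>O(\<surd>(n / r)) = O(1)\<close>.
  Points inside the circle are reflected to \<open>r\<^sup>2 / cnj a\<close>.
\<close>

section \<open>Kolmogorov's inequality for sums of simple fractions\<close>

lemma circle_mean_value:
  assumes "H holomorphic_on cball 0 r" "0 < r"
  shows "((\<lambda>\<theta>. H (of_real r * cis \<theta>)) has_integral of_real (2 * pi) * H 0) {0..2 * pi}"
proof -
  have "((\<lambda>u. H u / (u - 0)) has_contour_integral (2 * of_real pi * \<i> * H 0)) (circlepath 0 r)"
    using assms by (intro Cauchy_integral_circlepath holomorphic_on_imp_continuous_on)
      (auto elim: holomorphic_on_subset)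
  then have "((\<lambda>t. H (of_real r * cis t) / (of_real r * cis t) * of_real r * \<i> * cis t)
      has_integral 2 * of_real pi * \<i> * H 0) {0..2 * pi}"
    unfolding circlepath_def by (subst (asm) has_contour_integral_part_circlepath_iff) auto
  then have "((\<lambda>t. H (of_real r * cis t) * \<i>) has_integral 2 * of_real pi * \<i> * H 0) {0..2 * pi}"
    using assms(2) by (simp add: field_simps cis_neq_zero)
  from has_integral_mult_left[OF this, of "-\<i>"] show ?thesis
    by (simp add: algebra_simps)
qed

lemma Re_Herglotz_kernel_pos:
  fixes a z :: complex
  assumes "norm z < norm a"
  shows "0 < Re ((a + z) / (a - z))"
proof -
  have "Re ((a + z) * cnj (a - z)) = (norm a)\<^sup>2 - (norm z)\<^sup>2"
    unfolding cmod_power2 by (simp add: power2_eq_square algebra_simps)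
  also have "\<dots> > 0"
    using assms by (simp add: power_strict_mono)
  finally have "0 < Re ((a + z) * cnj (a - z))" .
  moreover have "a \<noteq> z" using assms by auto
  ultimately show ?thesis
    by (subst complex_div_cnj) (simp add: Re_divide_of_real del: complex_cnj_diff)
qed

text \<open>The principal root halves the argument, so it maps the right half plane into the sector
  \<open>\<bar>arg\<bar> \<le> \<pi>/4\<close>, on which the real part controls the modulus.\<close>
lemma sqrt_norm_le_Re_csqrt:
  assumes "0 \<le> Re w"
  shows "sqrt (norm w) \<le> sqrt 2 * Re (csqrt w)"
proof -
  have "norm w \<le> 2 * ((norm w + Re w) / 2)" using assms by simp
  then have "sqrt (norm w) \<le> sqrt (2 * ((norm w + Re w) / 2))"
    by (rule real_sqrt_le_mono)
  also have "\<dots> = sqrt 2 * Re (csqrt w)"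
    by (simp only: real_sqrt_mult csqrt.sel)
  finally show ?thesis .
qed

lemma Re_sum_list: "Re (\<Sum>a\<leftarrow>as. f a) = (\<Sum>a\<leftarrow>as. Re (f a))"
  by (induction as) auto

lemma sum_list_pos:
  fixes f :: "'a \<Rightarrow> real"
  assumes "as \<noteq> []" "\<And>a. a \<in> set as \<Longrightarrow> 0 < f a"
  shows "0 < (\<Sum>a\<leftarrow>as. f a)"
  using assms by (induction as rule: list_nonempty_induct) (auto intro: add_pos_pos)

lemma holomorphic_on_sum_list:
  assumes "\<And>a. a \<in> set as \<Longrightarrow> f a holomorphic_on A"
  shows "(\<lambda>z. \<Sum>a\<leftarrow>as. f a z) holomorphic_on A"
  using assms by (induction as) (auto intro!: holomorphic_intros)

text \<open>The mean of \<open>Re \<surd>G\<close> over the circle is its value at the centre, \<open>\<surd>n\<close>; the distance of the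
  points \<open>a\<close> to the circle does not enter.\<close>
lemma Kolmogorov_Herglotz:
  fixes as :: "complex list"
  assumes r: "0 < r" and as: "\<And>a. a \<in> set as \<Longrightarrow> r < norm a"
  shows "(\<integral>\<^sup>+\<theta>\<in>{0..2 * pi}. ennreal (sqrt (norm (\<Sum>a\<leftarrow>as.
            (a + of_real r * cis \<theta>) / (a - of_real r * cis \<theta>)))) \<partial>lborel)
         \<le> ennreal (2 * pi * (sqrt 2 * sqrt (length as)))"
proof (cases "as = []")
  case False
  define G where "G = (\<lambda>z. \<Sum>a\<leftarrow>as. (a + z) / (a - z))"
  have ne: "a - z \<noteq> 0" if "a \<in> set as" "norm z \<le> r" for a z
    using as[OF that(1)] that(2) by auto
  have Gpos: "0 < Re (G z)" if "norm z \<le> r" for z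
    unfolding G_def Re_sum_list using False that as
    by (intro sum_list_pos Re_Herglotz_kernel_pos) force+
  have G0: "G 0 = of_nat (length as)"
  proof -
    have "(\<Sum>a\<leftarrow>as. (a + 0) / (a - 0)) = (\<Sum>a\<leftarrow>as. (1::complex))"
      using as r by (intro arg_cong[where f = sum_list] map_cong) force+
    then show ?thesis by (simp add: G_def sum_list_triv)
  qed
  have "(\<lambda>z. csqrt (G z)) holomorphic_on cball 0 r"
  proof (intro holomorphic_on_csqrt')
    show "G holomorphic_on cball 0 r" unfolding G_def
      using ne by (intro holomorphic_on_sum_list holomorphic_intros) auto
    show "G z \<notin> \<real>\<^sub>\<le>\<^sub>0" if "z \<in> cball 0 r" for z
      using Gpos[of z] that by (auto simp: complex_nonpos_Reals_iff)
  qed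
  from has_integral_Re[OF circle_mean_value[OF this r]]
  have "((\<lambda>\<theta>. Re (csqrt (G (of_real r * cis \<theta>)))) has_integral 2 * pi * sqrt (length as)) {0..2 * pi}"
    by (simp add: G0 csqrt_of_real_nonneg del: csqrt.sel)
  from has_integral_mult_right[OF this, of "sqrt 2"]
  have int: "((\<lambda>\<theta>. sqrt 2 * Re (csqrt (G (of_real r * cis \<theta>))))
      has_integral sqrt 2 * (2 * pi * sqrt (length as))) {0..2 * pi}" .
  have "(\<integral>\<^sup>+\<theta>\<in>{0..2 * pi}. ennreal (sqrt (norm (G (of_real r * cis \<theta>)))) \<partial>lborel)
     \<le> (\<integral>\<^sup>+\<theta>\<in>{0..2 * pi}. ennreal (sqrt 2 * Re (csqrt (G (of_real r * cis \<theta>)))) \<partial>lborel)"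
    using r by (intro nn_integral_mono mult_right_mono ennreal_leI sqrt_norm_le_Re_csqrt
        less_imp_le[OF Gpos]) (auto simp: norm_mult)
  also have "\<dots> = ennreal (sqrt 2 * (2 * pi * sqrt (length as)))"
    by (intro nn_integral_has_integral_lebesgue' int mult_nonneg_nonneg Re_csqrt) auto
  finally show ?thesis unfolding G_def by (simp add: mult_ac)
qed simp

lemma sqrt_add_le:
  assumes "0 \<le> x" "0 \<le> y"
  shows "sqrt (x + y) \<le> sqrt x + sqrt y"
  using assms by (intro real_le_lsqrt) (auto simp: power2_sum)

lemma sum_list_affine:
  fixes f :: "'a \<Rightarrow> complex"
  shows "(\<Sum>a\<leftarrow>as. c * (f a + d)) = c * ((\<Sum>a\<leftarrow>as. f a) + of_nat (length as) * d)"
  by (induction as) (auto simp: algebra_simps)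

lemma measurable_sum_list [measurable (raw)]:
  fixes f :: "'a \<Rightarrow> 'b \<Rightarrow> complex"
  assumes "\<And>a. f a \<in> borel_measurable M"
  shows "(\<lambda>x. \<Sum>a\<leftarrow>as. f a x) \<in> borel_measurable M"
  using assms by (induction as) auto

lemma measurable_cis [measurable]: "cis \<in> borel_measurable borel"
  by (intro borel_measurable_continuous_onI continuous_intros)

text \<open>On the circle the sum \<open>S\<close> of the \<open>n\<close> simple fractions is \<open>(n - G) / (2 z)\<close> for points outside, and
  \<open>(n + cnj G) / (2 z)\<close> for points inside if \<open>G\<close> is formed with the reflected points. Both cases pass
  from the Herglotz sum \<open>G\<close> to \<open>S\<close> through this estimate.\<close>
lemma Kolmogorov_transfer:
  assumes r: "0 < r" and n: "0 \<le> n"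
    and le: "\<And>\<theta>. norm (S \<theta>) \<le> (norm (G \<theta>) + n) / (2 * r)"
    and [measurable]: "G \<in> borel_measurable borel"
    and G: "(\<integral>\<^sup>+\<theta>\<in>{0..2 * pi}. ennreal (sqrt (norm (G \<theta> :: complex))) \<partial>lborel)
         \<le> ennreal (2 * pi * (sqrt 2 * sqrt n))"
  shows "(\<integral>\<^sup>+\<theta>\<in>{0..2 * pi}. ennreal (sqrt (norm (S \<theta> :: complex))) \<partial>lborel)
         \<le> ennreal (2 * pi * (2 * sqrt (n / r)))"
proof -
  define k where "k = 1 / sqrt (2 * r)"
  have k: "0 \<le> k" using r by (simp add: k_def)
  have pt: "sqrt (norm (S \<theta>)) \<le> k * (sqrt (norm (G \<theta>)) + sqrt n)" for \<theta>
  proof -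
    have "sqrt (norm (S \<theta>)) \<le> sqrt ((norm (G \<theta>) + n) / (2 * r))"
      by (intro real_sqrt_le_mono le)
    also have "\<dots> = k * sqrt (norm (G \<theta>) + n)"
      by (simp add: k_def real_sqrt_divide)
    also have "\<dots> \<le> k * (sqrt (norm (G \<theta>)) + sqrt n)"
      using n k by (intro mult_left_mono sqrt_add_le) auto
    finally show ?thesis .
  qed
  have "(\<integral>\<^sup>+\<theta>\<in>{0..2 * pi}. ennreal (sqrt (norm (S \<theta>))) \<partial>lborel)
     \<le> (\<integral>\<^sup>+\<theta>. ennreal k * (ennreal (sqrt (norm (G \<theta>))) * indicator {0..2 * pi} \<theta>
           + ennreal (sqrt n) * indicator {0..2 * pi} \<theta>) \<partial>lborel)"
  proof (intro nn_integral_mono)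
    fix \<theta> :: real
    show "ennreal (sqrt (norm (S \<theta>))) * indicator {0..2 * pi} \<theta> \<le>
       ennreal k * (ennreal (sqrt (norm (G \<theta>))) * indicator {0..2 * pi} \<theta>
           + ennreal (sqrt n) * indicator {0..2 * pi} \<theta>)"
      using ennreal_leI[OF pt[of \<theta>]] k n
      by (cases "\<theta> \<in> {0..2 * pi}") (auto simp: ennreal_mult)
  qed
  also have "\<dots> = ennreal k * ((\<integral>\<^sup>+\<theta>\<in>{0..2 * pi}. ennreal (sqrt (norm (G \<theta>))) \<partial>lborel)
        + ennreal (2 * pi * sqrt n))"
    using n by (simp add: nn_integral_cmult nn_integral_add nn_integral_cmult_indicator ennreal_mult mult_ac)
  also have "\<dots> \<le> ennreal k * (ennreal (2 * pi * (sqrt 2 * sqrt n)) + ennreal (2 * pi * sqrt n))"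
    by (intro mult_left_mono add_right_mono G) auto
  also have "\<dots> = ennreal (k * (2 * pi * (sqrt 2 * sqrt n) + 2 * pi * sqrt n))"
    using n k by (simp flip: ennreal_mult ennreal_plus)
  also have "\<dots> \<le> ennreal (2 * pi * (2 * sqrt (n / r)))"
  proof (rule ennreal_leI)
    \<comment> \<open>The factor 2 in the conclusion is a round bound for \<open>1 + 1 / \<surd>2\<close>.\<close>
    have "k * (2 * pi * (sqrt 2 * sqrt n) + 2 * pi * sqrt n)
        = 2 * pi * ((1 + 1 / sqrt 2) * sqrt (n / r))"
      by (simp add: k_def real_sqrt_mult real_sqrt_divide field_simps)
    also have "\<dots> \<le> 2 * pi * (2 * sqrt (n / r))"
      using n r by (intro mult_left_mono mult_right_mono) auto
    finally show "k * (2 * pi * (sqrt 2 * sqrt n) + 2 * pi * sqrt n) \<le> 2 * pi * (2 * sqrt (n / r))" .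
  qed
  finally show ?thesis .
qed

lemma Kolmogorov_outside:
  fixes as :: "complex list"
  assumes r: "0 < r" and as: "\<And>a. a \<in> set as \<Longrightarrow> r < norm a"
  shows "(\<integral>\<^sup>+\<theta>\<in>{0..2 * pi}. ennreal (sqrt (norm (\<Sum>a\<leftarrow>as. 1 / (of_real r * cis \<theta> - a)))) \<partial>lborel)
         \<le> ennreal (2 * pi * (2 * sqrt (length as / r)))"
proof (rule Kolmogorov_transfer[OF r _ _ _ Kolmogorov_Herglotz[OF r as]])
  fix \<theta> :: real
  define z where "z = of_real r * cis \<theta>"
  have z: "norm z = r" "z \<noteq> 0" using r by (auto simp: z_def norm_mult)
  have "(\<Sum>a\<leftarrow>as. 1 / (z - a)) = (\<Sum>a\<leftarrow>as. - 1 / (2 * z) * ((a + z) / (a - z) + - 1))"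
  proof (intro arg_cong[where f = sum_list] map_cong refl)
    fix a assume "a \<in> set as"
    then have "a \<noteq> z" using as z by force
    then show "1 / (z - a) = - 1 / (2 * z) * ((a + z) / (a - z) + - 1)"
      using z(2) by (simp add: divide_simps)
  qed
  also have "\<dots> = - 1 / (2 * z) * ((\<Sum>a\<leftarrow>as. (a + z) / (a - z)) + of_nat (length as) * - 1)"
    by (rule sum_list_affine)
  finally have "norm (\<Sum>a\<leftarrow>as. 1 / (z - a))
      = norm ((\<Sum>a\<leftarrow>as. (a + z) / (a - z)) - of_nat (length as)) / (2 * r)"
    using z by (simp add: norm_mult norm_divide)
  also have "\<dots> \<le> (norm (\<Sum>a\<leftarrow>as. (a + z) / (a - z)) + length as) / (2 * r)"
    using r norm_triangle_ineq4[of "\<Sum>a\<leftarrow>as. (a + z) / (a - z)" "of_nat (length as)"]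
    by (intro divide_right_mono) auto
  finally show "norm (\<Sum>a\<leftarrow>as. 1 / (of_real r * cis \<theta> - a)) \<le>
      (norm (\<Sum>a\<leftarrow>as. (a + of_real r * cis \<theta>) / (a - of_real r * cis \<theta>)) + length as) / (2 * r)"
    by (simp only: z_def)
qed (use assms in \<open>auto\<close>)

text \<open>On the circle, \<open>cnj z = r\<^sup>2 / z\<close>, hence \<open>(z + a) / (z - a)\<close> is the conjugate of
  \<open>(b + z) / (b - z)\<close> for the reflected point \<open>b = r\<^sup>2 / cnj a\<close>, which lies outside.\<close>
lemma Kolmogorov_inside:
  fixes as :: "complex list"
  assumes r: "0 < r" and as: "\<And>a. a \<in> set as \<Longrightarrow> norm a < r \<and> a \<noteq> 0"
  shows "(\<integral>\<^sup>+\<theta>\<in>{0..2 * pi}. ennreal (sqrt (norm (\<Sum>a\<leftarrow>as. 1 / (of_real r * cis \<theta> - a)))) \<partial>lborel)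
         \<le> ennreal (2 * pi * (2 * sqrt (length as / r)))"
proof -
  define bs where "bs = map (\<lambda>a. of_real (r\<^sup>2) / cnj a) as"
  have [simp]: "length bs = length as" by (simp add: bs_def)
  have bs: "r < norm b" if b: "b \<in> set bs" for b
  proof -
    obtain a where a: "a \<in> set as" "b = of_real (r\<^sup>2) / cnj a" using b by (auto simp: bs_def)
    then have "norm b = r\<^sup>2 / norm a" "norm a < r" "0 < norm a"
      using as r by (auto simp: norm_divide norm_power)
    moreover from this have "r * norm a < r\<^sup>2" using r by (simp add: power2_eq_square)
    ultimately show ?thesis by (simp add: pos_less_divide_eq)
  qed
  have mean: "(\<integral>\<^sup>+\<theta>\<in>{0..2 * pi}. ennreal (sqrt (norm (\<Sum>b\<leftarrow>bs.
            (b + of_real r * cis \<theta>) / (b - of_real r * cis \<theta>)))) \<partial>lborel)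
         \<le> ennreal (2 * pi * (sqrt 2 * sqrt (length as)))"
    using Kolmogorov_Herglotz[of r bs, OF r bs] by simp
  show ?thesis
  proof (rule Kolmogorov_transfer[OF r _ _ _ mean])
    fix \<theta> :: real
    define z where "z = of_real r * cis \<theta>"
    have z: "norm z = r" "z \<noteq> 0" using r by (auto simp: z_def norm_mult)
    have zz: "of_real (r\<^sup>2) = z * cnj z" using z(1) complex_norm_square[of z] by simp
    have "(\<Sum>a\<leftarrow>as. 1 / (z - a)) = (\<Sum>a\<leftarrow>as. 1 / (2 * z) * ((z + a) / (z - a) + 1))"
    proof (intro arg_cong[where f = sum_list] map_cong refl)
      fix a assume "a \<in> set as"
      then have "a \<noteq> z" using as z by force
      then show "1 / (z - a) = 1 / (2 * z) * ((z + a) / (z - a) + 1)"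
        using z(2) by (simp add: divide_simps)
    qed
    also have "\<dots> = 1 / (2 * z) * ((\<Sum>a\<leftarrow>as. (z + a) / (z - a)) + of_nat (length as) * 1)"
      by (rule sum_list_affine)
    also have "(\<Sum>a\<leftarrow>as. (z + a) / (z - a)) = cnj (\<Sum>b\<leftarrow>bs. (b + z) / (b - z))"
    proof -
      have "cnj (\<Sum>b\<leftarrow>bs. (b + z) / (b - z)) = (\<Sum>b\<leftarrow>bs. cnj ((b + z) / (b - z)))"
        by (induction bs) auto
      also have "\<dots> = (\<Sum>a\<leftarrow>as. (z + a) / (z - a))"
        unfolding bs_def map_map o_def
      proof (intro arg_cong[where f = sum_list] map_cong refl)
        fix a assume "a \<in> set as"
        then have a: "a \<noteq> z" "a \<noteq> 0" using as z by force+
        then have "cnj z \<noteq> cnj a" "z - a \<noteq> 0" by auto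
        then show "cnj ((of_real (r\<^sup>2) / cnj a + z) / (of_real (r\<^sup>2) / cnj a - z)) = (z + a) / (z - a)"
          using a z(2) unfolding zz by (simp add: divide_simps) (simp add: algebra_simps)
      qed
      finally show ?thesis by simp
    qed
    finally have "norm (\<Sum>a\<leftarrow>as. 1 / (z - a))
        = norm (cnj (\<Sum>b\<leftarrow>bs. (b + z) / (b - z)) + of_nat (length as)) / (2 * r)"
      using z by (simp add: norm_mult norm_divide)
    also have "\<dots> \<le> (norm (\<Sum>b\<leftarrow>bs. (b + z) / (b - z)) + length as) / (2 * r)"
      using r norm_triangle_ineq[of "cnj (\<Sum>b\<leftarrow>bs. (b + z) / (b - z))" "of_nat (length as)"]
      by (intro divide_right_mono) auto
    finally show "norm (\<Sum>a\<leftarrow>as. 1 / (of_real r * cis \<theta> - a)) \<le>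
        (norm (\<Sum>b\<leftarrow>bs. (b + of_real r * cis \<theta>) / (b - of_real r * cis \<theta>)) + length as) / (2 * r)"
      by (simp only: z_def)
  qed (use assms in \<open>auto\<close>)
qed

section \<open>Splitting off the zeros in a disc\<close>

text \<open>The factor \<open>1 - z / a\<close> is normalized so that the quotient keeps the value at the origin.\<close>
lemma entire_divide_zero:
  assumes g: "g holomorphic_on UNIV" and a: "g a = 0" "a \<noteq> (0::complex)"
  shows "\<exists>h. h holomorphic_on UNIV \<and> (\<forall>z. g z = (1 - z / a) * h z)"
proof -
  define q where "q = (\<lambda>z. if z = a then deriv g a else (g z - g a) / (z - a))"
  have "q holomorphic_on UNIV" unfolding q_def by (rule pole_lemma) (use g in auto)
  then have "(\<lambda>z. - a * q z) holomorphic_on UNIV" by (intro holomorphic_intros)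
  moreover have "g z = (1 - z / a) * (- a * q z)" for z
    using a by (auto simp: q_def divide_simps algebra_simps)
  ultimately show ?thesis by blast
qed

text \<open>Zeros are split off one at a time. On the circle of radius \<open>8 r\<close> each factor \<open>1 - z / a\<close> with
  \<open>\<bar>a\<bar> \<le> 2 r\<close> has modulus at least 3, so after \<open>n\<close> steps the maximum principle gives
  \<open>\<bar>g\<bar> \<le> exp K / 3\<^sup>n\<close> in the disc. At the origin this reads \<open>3\<^sup>n \<le> exp K\<close>: the process stops, and
  a longest list of factors leaves no zero behind.\<close>
lemma disc_factorization:
  assumes f: "f holomorphic_on UNIV" "f 0 = 1" and r: "0 < r"
    and bound: "\<And>z. norm z = 8 * r \<Longrightarrow> norm (f z) \<le> exp K"
  shows "\<exists>(as :: complex list) g. (\<forall>a\<in>set as. a \<noteq> 0) \<and> g holomorphic_on UNIV \<and> g 0 = 1 \<and>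
    (\<forall>z. f z = (\<Prod>a\<leftarrow>as. 1 - z / a) * g z) \<and>
    (\<forall>z. norm z \<le> 2 * r \<longrightarrow> g z \<noteq> 0 \<and> norm (g z) \<le> exp K) \<and> real (length as) \<le> K"
proof -
  define P where "P = (\<lambda>as g. (\<forall>a\<in>set as. a \<noteq> 0 \<and> norm a \<le> 2 * r) \<and> g holomorphic_on UNIV \<and>
     (\<forall>z. f z = (\<Prod>a\<leftarrow>as. 1 - z / a) * g z))"
  have g0: "g 0 = 1" if "P as g" for as g
  proof -
    have "(\<Prod>a\<leftarrow>as. 1 - 0 / a) = (1::complex)" by (induction as) auto
    moreover have "f 0 = (\<Prod>a\<leftarrow>as. 1 - 0 / a) * g 0" using that by (simp only: P_def)
    ultimately show ?thesis using f by simp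
  qed
  have gle: "norm (g z) \<le> exp K / 3 ^ length as" if P: "P as g" and z: "norm z \<le> 8 * r" for as g z
  proof (rule maximum_modulus_frontier[where S = "cball 0 (8 * r)" and f = g])
    fix w :: complex assume "w \<in> frontier (cball 0 (8 * r))"
    then have w: "norm w = 8 * r" using r by auto
    have prod: "3 ^ length bs \<le> norm (\<Prod>a\<leftarrow>bs. 1 - w / a)"
      if "\<forall>a\<in>set bs. a \<noteq> 0 \<and> norm a \<le> 2 * r" for bs
      using that
    proof (induction bs)
      case (Cons a bs)
      have "4 * norm a \<le> norm w" "0 < norm a" using Cons.prems w by auto
      then have "4 \<le> norm (w / a)" by (simp add: norm_divide field_simps)
      then have "3 \<le> norm (1 - w / a)" using norm_triangle_ineq2[of "w / a" 1]
        by (simp add: norm_minus_commute)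
      then show ?case using Cons by (auto simp: norm_mult intro!: mult_mono)
    qed simp
    have "3 ^ length as * norm (g w) \<le> norm (\<Prod>a\<leftarrow>as. 1 - w / a) * norm (g w)"
      using P by (intro mult_right_mono prod) (auto simp: P_def)
    also have "\<dots> = norm (f w)" using P by (simp add: P_def norm_mult)
    also have "\<dots> \<le> exp K" by (rule bound[OF w])
    finally show "norm (g w) \<le> exp K / 3 ^ length as" by (simp add: field_simps)
  qed (use P z in \<open>auto simp: P_def intro: holomorphic_on_imp_continuous_on holomorphic_on_subset\<close>)
  have len: "real (length as) \<le> K" if P: "P as g" for as g
  proof -
    have "1 \<le> exp K / 3 ^ length as" using gle[OF P, of 0] g0[OF P] r by simp
    then have "3 ^ length as \<le> exp K" by (simp add: field_simps)
    moreover have "exp (real (length as)) \<le> 3 ^ length as"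
      using power_mono[OF exp_le, of "length as"] by (simp flip: exp_of_nat_mult)
    ultimately have "exp (real (length as)) \<le> exp K" by linarith
    then show ?thesis by simp
  qed
  \<comment> \<open>The numbers of factors are bounded by \<open>K\<close>, so one of them is the greatest.\<close>
  have "\<exists>as g. P as g \<and> (\<forall>as' g'. P as' g' \<longrightarrow> length as' \<le> length as)"
  proof -
    define Q where "Q = (\<lambda>n. \<exists>as g. P as g \<and> length as = n)"
    have "P [] f" using f by (simp add: P_def)
    then have "Q 0" by (auto simp: Q_def)
    moreover have bdd: "n \<le> nat \<lfloor>K\<rfloor>" if n: "Q n" for n
    proof -
      from n obtain as g where "P as g" "length as = n" unfolding Q_def by blast
      with len show ?thesis by (auto intro: le_nat_floor)
    qed
    ultimately have "Q (Greatest Q)" by (rule GreatestI_nat)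
    then obtain as g where "P as g" "length as = Greatest Q" unfolding Q_def by blast
    moreover have "length as' \<le> Greatest Q" if "P as' g'" for as' g'
    proof -
      have "Q (length as')" using that unfolding Q_def by blast
      then show ?thesis using bdd by (rule Greatest_le_nat)
    qed
    ultimately show ?thesis by auto
  qed
  then obtain as g where P: "P as g" and max: "\<And>as' g'. P as' g' \<Longrightarrow> length as' \<le> length as"
    by blast
  have nz: "g a \<noteq> 0" if a: "norm a \<le> 2 * r" for a
  proof
    assume ga: "g a = 0"
    then have a0: "a \<noteq> 0" using g0[OF P] by auto
    from P have "g holomorphic_on UNIV" by (simp add: P_def)
    from entire_divide_zero[OF this ga a0] obtain h
      where h: "h holomorphic_on UNIV" "\<And>z. g z = (1 - z / a) * h z" by blast
    then have "P (a # as) h" using P a a0 by (simp add: P_def mult_ac)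
    from max[OF this] show False by simp
  qed
  have "norm (g z) \<le> exp K" if "norm z \<le> 2 * r" for z
  proof -
    have "norm (g z) \<le> exp K / 3 ^ length as" using gle[OF P, of z] that r by simp
    also have "\<dots> \<le> exp K / 1" by (intro divide_left_mono) auto
    finally show ?thesis by simp
  qed
  moreover have "\<forall>a\<in>set as. a \<noteq> 0" "g holomorphic_on UNIV" "\<forall>z. f z = (\<Prod>a\<leftarrow>as. 1 - z / a) * g z"
    using P by (simp_all add: P_def)
  ultimately show ?thesis using g0[OF P] nz len[OF P]
    by (intro exI[of _ as] exI[of _ g] conjI) auto
qed

lemma DERIV_prod_linear_factors:
  fixes z :: complex
  assumes "\<And>a. a \<in> set as \<Longrightarrow> a \<noteq> 0 \<and> a \<noteq> z"
  shows "((\<lambda>w. \<Prod>a\<leftarrow>as. 1 - w / a) has_field_derivative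
     (\<Prod>a\<leftarrow>as. 1 - z / a) * (\<Sum>a\<leftarrow>as. 1 / (z - a))) (at z)"
  using assms
proof (induction as)
  case (Cons a as)
  then have a: "a \<noteq> 0" "a \<noteq> z" by auto
  have 1: "((\<lambda>w. 1 - w / a) has_field_derivative - 1 / a) (at z)"
    by (auto intro!: derivative_eq_intros simp: a)
  have "((\<lambda>w. (1 - w / a) * (\<Prod>a\<leftarrow>as. 1 - w / a)) has_field_derivative
     (- 1 / a) * (\<Prod>a\<leftarrow>as. 1 - z / a) +
     (\<Prod>a\<leftarrow>as. 1 - z / a) * (\<Sum>a\<leftarrow>as. 1 / (z - a)) * (1 - z / a)) (at z)"
    using Cons by (intro DERIV_mult 1 Cons.IH) auto
  also have "- 1 / a = (1 - z / a) * (1 / (z - a))"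
    using a by (simp add: divide_simps)
  also have "\<dots> * (\<Prod>a\<leftarrow>as. 1 - z / a) +
      (\<Prod>a\<leftarrow>as. 1 - z / a) * (\<Sum>a\<leftarrow>as. 1 / (z - a)) * (1 - z / a)
    = (1 - z / a) * (\<Prod>a\<leftarrow>as. 1 - z / a) * (1 / (z - a) + (\<Sum>a\<leftarrow>as. 1 / (z - a)))"
    by (simp only: algebra_simps)
  finally show ?case by simp
qed simp

section \<open>The zero-free factor\<close>

text \<open>The Moebius map \<open>h \<mapsto> h / (2 K - h)\<close> takes the half plane \<open>Re h < K\<close> to the unit disc and fixes
  the origin, so Schwarz's lemma applies.\<close>
lemma Borel_Caratheodory:
  assumes h: "h holomorphic_on ball 0 R" "h 0 = 0"
    and Re: "\<And>z. norm z < R \<Longrightarrow> Re (h z) < K" and z: "norm z < R"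
  shows "norm (h z) \<le> 2 * K * norm z / (R - norm z)"
proof -
  have R: "0 < R" using z norm_ge_zero[of z] by linarith
  have K: "0 < K" using Re[of 0] R h by simp
  have lt: "norm (h w) < norm (2 * of_real K - h w)" if "norm w < R" for w
  proof -
    have "(norm (h w))\<^sup>2 < (norm (2 * of_real K - h w))\<^sup>2"
    proof -
      have "(norm (2 * of_real K - h w))\<^sup>2 - (norm (h w))\<^sup>2 = 4 * K * (K - Re (h w))"
        unfolding cmod_power2 by (simp add: power2_eq_square algebra_simps)
      also have "\<dots> > 0" using K Re[OF that] by simp
      finally show ?thesis by simp
    qed
    then show ?thesis by (rule power_less_imp_less_base) simp
  qed
  define \<phi> where "\<phi> = (\<lambda>w. h (of_real R * w) / (2 * of_real K - h (of_real R * w)))"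
  have dom: "norm (of_real R * w) < R" if "norm w < 1" for w :: complex
    using that R by (simp add: norm_mult)
  have ne: "2 * of_real K - h (of_real R * w) \<noteq> 0" if "norm w < 1" for w
    using lt[OF dom[OF that]] by auto
  have hR: "(\<lambda>w. h (of_real R * w)) holomorphic_on ball 0 1"
    using dom by (intro holomorphic_on_compose_gen[OF _ h(1), unfolded o_def] holomorphic_intros)
      auto
  have "norm (\<phi> (z / of_real R)) \<le> norm (z / of_real R)"
  proof (rule Schwarz_Lemma(1))
    show "\<phi> holomorphic_on ball 0 1"
      unfolding \<phi>_def using ne by (intro holomorphic_intros hR) auto
    show "\<phi> 0 = 0" by (simp add: \<phi>_def h)
    show "norm (\<phi> w) < 1" if "norm w < 1" for w
      using lt[OF dom[OF that]] by (auto simp: \<phi>_def norm_divide divide_simps)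
    show "norm (z / of_real R) < 1" using z R by (simp add: norm_divide)
  qed
  then have "norm (h z) / norm (2 * of_real K - h z) \<le> norm z / R"
    using R by (simp add: \<phi>_def norm_divide)
  moreover have "0 < norm (2 * of_real K - h z)" using lt[OF z] norm_ge_zero[of "h z"] by linarith
  ultimately have "norm (h z) * R \<le> norm z * norm (2 * of_real K - h z)"
    using R by (simp add: divide_simps mult_ac split: if_splits)
  also have "\<dots> \<le> norm z * (2 * K + norm (h z))"
    using K norm_triangle_ineq4[of "2 * of_real K" "h z"] by (intro mult_left_mono) auto
  finally have "norm (h z) * (R - norm z) \<le> 2 * K * norm z" by (simp add: algebra_simps)
  then show ?thesis using z by (simp add: field_simps)
qed

text \<open>The logarithm of \<open>g\<close> has real part below \<open>K\<close> on the disc of radius \<open>2 r\<close>, hence modulus at most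
  \<open>6 K\<close> on that of radius \<open>3 r / 2\<close>; Cauchy's estimate on discs of radius \<open>r / 2\<close> then bounds its
  derivative.\<close>
lemma log_deriv_zero_free_bound:
  assumes g: "g holomorphic_on ball 0 (2 * r)" "g 0 = 1"
    and nz: "\<And>z. norm z < 2 * r \<Longrightarrow> g z \<noteq> 0"
    and le: "\<And>z. norm z < 2 * r \<Longrightarrow> norm (g z) < exp K"
    and z: "norm z = r" and r: "0 < r"
  shows "norm (deriv g z / g z) \<le> 12 * K / r"
proof -
  obtain h0 where h0: "h0 holomorphic_on ball 0 (2 * r)"
    "\<And>x. x \<in> ball 0 (2 * r) \<Longrightarrow> exp (h0 x) = g x"
    by (rule holomorphic_logarithm_exists[OF _ _ g(1), of 0]) (use nz r in auto)
  define h where "h = (\<lambda>z. h0 z - h0 0)"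
  have h: "h holomorphic_on ball 0 (2 * r)" "h 0 = 0"
    unfolding h_def by (auto intro!: holomorphic_intros h0)
  have "exp (h0 0) = 1" using h0(2)[of 0] g r by simp
  then have eh: "exp (h x) = g x" if "norm x < 2 * r" for x
    using h0(2)[of x] that by (simp add: h_def exp_diff)
  have "Re (h x) < K" if "norm x < 2 * r" for x
  proof -
    have "exp (Re (h x)) < exp K" using le[OF that] eh[OF that] by (metis norm_exp_eq_Re)
    then show ?thesis by simp
  qed
  note BC = Borel_Caratheodory[OF h this]
  have K: "0 < K" using le[of 0] g r by simp
  have bd: "norm (h x) \<le> 6 * K" if "norm (z - x) = r / 2" for x
  proof -
    have x: "norm x \<le> 3 / 2 * r" using that z norm_triangle_sub[of x z]
      by (simp add: norm_minus_commute)
    then have "norm (h x) \<le> 2 * K * norm x / (2 * r - norm x)" using r by (intro BC) auto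
    also have "\<dots> \<le> 2 * K * (3 / 2 * r) / (r / 2)"
      using x r K by (intro frac_le mult_left_mono) auto
    finally show ?thesis using r by simp
  qed
  have sub: "cball z (r / 2) \<subseteq> ball 0 (2 * r)"
  proof
    fix x assume "x \<in> cball z (r / 2)"
    then have "norm (x - z) \<le> r / 2" by (simp add: dist_norm norm_minus_commute)
    then show "x \<in> ball 0 (2 * r)" using z r norm_triangle_sub[of x z] by simp
  qed
  have "norm ((deriv ^^ 1) h z) \<le> fact 1 * (6 * K) / (r / 2) ^ 1"
  proof (rule Cauchy_inequality[OF _ _ _ bd])
    show "continuous_on (cball z (r / 2)) h"
      using holomorphic_on_imp_continuous_on[OF h(1)] sub continuous_on_subset by blast
    show "h holomorphic_on ball z (r / 2)"
      using h(1) by (rule holomorphic_on_subset) (use sub in auto)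
  qed (use r in auto)
  then have dh: "norm (deriv h z) \<le> 12 * K / r" by simp
  have zin: "z \<in> ball 0 (2 * r)" using z r by simp
  have "(h has_field_derivative deriv h z) (at z)"
    using h(1) zin by (intro holomorphic_derivI) auto
  then have "((\<lambda>x. exp (h x)) has_field_derivative exp (h z) * deriv h z) (at z)"
    by (rule DERIV_chain2[OF DERIV_exp])
  then have "(g has_field_derivative exp (h z) * deriv h z) (at z)"
    by (rule has_field_derivative_transform_within_open[where S = "ball 0 (2 * r)"])
      (use zin eh in auto)
  then have "deriv g z = g z * deriv h z" using eh[of z] zin by (simp add: DERIV_imp_deriv)
  then have "deriv g z / g z = deriv h z" using nz[of z] zin by simp
  then show ?thesis using dh by simp
qed

section \<open>Entire functions of exponential type\<close>

lemma log_plus_le_sqrt: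
  assumes "0 \<le> x"
  shows "log_plus x \<le> 2 * sqrt x"
proof (cases "x = 0")
  case False
  then have "ln x = 2 * ln (sqrt x)" using assms by (simp add: ln_sqrt)
  also have "\<dots> \<le> 2 * sqrt x" using ln_bound[of "sqrt x"] False assms by simp
  finally show ?thesis using False assms by (simp add: log_plus_def)
qed (simp add: log_plus_def)

text \<open>The bound depends on the type \<open>B\<close> alone: the number of zeros and the size of \<open>log g\<close> both grow
  like \<open>B r\<close>, and both contributions are divided by \<open>r\<close>.\<close>
lemma proximity_log_deriv_exponential_type:
  assumes f: "f holomorphic_on UNIV" "f 0 = 1"
    and B: "0 < B" "\<And>z. norm (f z) \<le> exp (B * norm z)"
    and r: "0 < r" and nz: "\<And>z. norm z = r \<Longrightarrow> f z \<noteq> 0"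
  shows "proximity r (\<lambda>z. deriv f z / f z) \<le> ennreal (2 * (4 * sqrt (8 * B) + sqrt (108 * B)))"
proof -
  have bound: "norm (f z) \<le> exp (8 * B * r)" if "norm z = 8 * r" for z
    using B(2)[of z] that by (simp add: mult_ac)
  obtain as g where as: "\<And>a. a \<in> set as \<Longrightarrow> a \<noteq> 0" and g: "g holomorphic_on UNIV" "g 0 = 1"
    and fg: "\<And>z. f z = (\<Prod>a\<leftarrow>as. 1 - z / a) * g z"
    and gnz: "\<And>z. norm z \<le> 2 * r \<Longrightarrow> g z \<noteq> 0"
    and gle: "\<And>z. norm z \<le> 2 * r \<Longrightarrow> norm (g z) \<le> exp (8 * B * r)"
    and len: "real (length as) \<le> 8 * B * r"
    using disc_factorization[OF f r bound] by blast
  have asr: "norm a \<noteq> r" if "a \<in> set as" for a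
  proof
    assume "norm a = r"
    have "(\<Prod>b\<leftarrow>as. 1 - a / b) = 0" using that as[OF that] by (force simp: prod_list_zero_iff)
    then have "f a = 0" by (simp add: fg)
    with nz[OF \<open>norm a = r\<close>] show False by simp
  qed
  have gbound: "norm (deriv g z / g z) \<le> 108 * B" if z: "norm z = r" for z
  proof -
    have "norm (deriv g z / g z) \<le> 12 * (9 * B * r) / r"
    proof (rule log_deriv_zero_free_bound[where g = g and K = "9 * B * r", OF _ g(2) _ _ z r])
      \<comment> \<open>9 in place of 8 makes the bound strict.\<close>
      show "norm (g w) < exp (9 * B * r)" if "norm w < 2 * r" for w
      proof -
        have "norm (g w) \<le> exp (8 * B * r)" using gle that by simp
        also have "\<dots> < exp (9 * B * r)" using B r by simp
        finally show ?thesis .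
      qed
    qed (use gnz g in \<open>auto elim: holomorphic_on_subset\<close>)
    then show ?thesis using r by simp
  qed
  define ins where "ins = filter (\<lambda>a. norm a < r) as"
  define outs where "outs = filter (\<lambda>a. \<not> norm a < r) as"
  define S where "S = (\<lambda>bs \<theta>. \<Sum>a\<leftarrow>bs. 1 / (of_real r * cis \<theta> - a))"
  have split: "deriv f z / f z = S ins \<theta> + S outs \<theta> + deriv g z / g z"
    if z: "z = of_real r * cis \<theta>" for z \<theta>
  proof -
    have nzr: "norm z = r" using z r by (simp add: norm_mult)
    then have asz: "a \<noteq> 0 \<and> a \<noteq> z" if "a \<in> set as" for a using as asr that by blast
    have gz: "g z \<noteq> 0" using gnz[of z] nzr r by simp
    have pz: "(\<Prod>a\<leftarrow>as. 1 - z / a) \<noteq> 0" using nz[OF nzr] fg[of z] by auto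
    have "(g has_field_derivative deriv g z) (at z)"
      using g(1) by (intro holomorphic_derivI) auto
    from DERIV_mult[OF DERIV_prod_linear_factors[of as z, OF asz] this]
    have "(f has_field_derivative (\<Prod>a\<leftarrow>as. 1 - z / a) * (\<Sum>a\<leftarrow>as. 1 / (z - a)) * g z
        + deriv g z * (\<Prod>a\<leftarrow>as. 1 - z / a)) (at z)"
      by (simp add: fg[abs_def])
    from DERIV_imp_deriv[OF this] have "deriv f z / f z = (\<Sum>a\<leftarrow>as. 1 / (z - a)) + deriv g z / g z"
      using gz pz by (simp add: fg[of z] field_simps)
    also have "(\<Sum>a\<leftarrow>as. 1 / (z - a)) = S ins \<theta> + S outs \<theta>"
      unfolding S_def ins_def outs_def z by (induction as) auto
    finally show ?thesis .
  qed
  have pt: "log_plus (norm (deriv f (of_real r * cis \<theta>) / f (of_real r * cis \<theta>))) \<le>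
     2 * (sqrt (norm (S ins \<theta>)) + sqrt (norm (S outs \<theta>)) + sqrt (108 * B))" for \<theta>
  proof -
    define z where "z = of_real r * cis \<theta>"
    have nzr: "norm z = r" using z_def r by (simp add: norm_mult)
    have "norm (deriv f z / f z) \<le> norm (S ins \<theta>) + norm (S outs \<theta>) + 108 * B"
      unfolding split[OF z_def]
      using gbound[OF nzr] norm_triangle_ineq[of "S ins \<theta> + S outs \<theta>" "deriv g z / g z"]
        norm_triangle_ineq[of "S ins \<theta>" "S outs \<theta>"] by linarith
    then have "sqrt (norm (deriv f z / f z)) \<le> sqrt (norm (S ins \<theta>) + norm (S outs \<theta>) + 108 * B)"
      by (rule real_sqrt_le_mono)
    also have "\<dots> \<le> sqrt (norm (S ins \<theta>)) + sqrt (norm (S outs \<theta>)) + sqrt (108 * B)"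
      using sqrt_add_le[of "norm (S ins \<theta>) + norm (S outs \<theta>)" "108 * B"]
        sqrt_add_le[of "norm (S ins \<theta>)" "norm (S outs \<theta>)"] B by simp
    finally show ?thesis using log_plus_le_sqrt[of "norm (deriv f z / f z)"]
      unfolding z_def by simp
  qed
  have meas [measurable]: "S bs \<in> borel_measurable borel" for bs
    unfolding S_def by measurable
  have lens: "sqrt (length bs / r) \<le> sqrt (8 * B)" if "length bs \<le> length as" for bs :: "complex list"
    using len that r by (intro real_sqrt_le_mono) (simp add: field_simps)
  let ?I = "indicator {0..2 * pi} :: real \<Rightarrow> ennreal"
  have I_in: "(\<integral>\<^sup>+\<theta>\<in>{0..2 * pi}. ennreal (sqrt (norm (S ins \<theta>))) \<partial>lborel) \<le> ennreal (2 * pi * (2 * sqrt (8 * B)))"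
    unfolding S_def using as lens[of ins]
    by (intro order_trans[OF Kolmogorov_inside[OF r]] ennreal_leI mult_left_mono)
      (auto simp: ins_def)
  have I_out: "(\<integral>\<^sup>+\<theta>\<in>{0..2 * pi}. ennreal (sqrt (norm (S outs \<theta>))) \<partial>lborel) \<le> ennreal (2 * pi * (2 * sqrt (8 * B)))"
    unfolding S_def using asr lens[of outs]
    by (intro order_trans[OF Kolmogorov_outside[OF r]] ennreal_leI mult_left_mono)
      (force simp: outs_def)+
  have "(\<integral>\<^sup>+\<theta>\<in>{0..2 * pi}. ennreal (log_plus (norm (deriv f (of_real r * cis \<theta>) / f (of_real r * cis \<theta>)))) \<partial>lborel)
     \<le> (\<integral>\<^sup>+\<theta>. 2 * (ennreal (sqrt (norm (S ins \<theta>))) * ?I \<theta> + ennreal (sqrt (norm (S outs \<theta>))) * ?I \<theta>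
          + ennreal (sqrt (108 * B)) * ?I \<theta>) \<partial>lborel)"
  proof (intro nn_integral_mono)
    fix \<theta> :: real
    have "ennreal (log_plus (norm (deriv f (of_real r * cis \<theta>) / f (of_real r * cis \<theta>))))
      \<le> 2 * (ennreal (sqrt (norm (S ins \<theta>))) + ennreal (sqrt (norm (S outs \<theta>))) + ennreal (sqrt (108 * B)))"
      using ennreal_leI[OF pt[of \<theta>]] B by (simp add: ennreal_mult ennreal_plus)
    then show "ennreal (log_plus (norm (deriv f (of_real r * cis \<theta>) / f (of_real r * cis \<theta>)))) * ?I \<theta>
      \<le> 2 * (ennreal (sqrt (norm (S ins \<theta>))) * ?I \<theta> + ennreal (sqrt (norm (S outs \<theta>))) * ?I \<theta>
          + ennreal (sqrt (108 * B)) * ?I \<theta>)"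
      by (cases "\<theta> \<in> {0..2 * pi}") auto
  qed
  also have "\<dots> = 2 * ((\<integral>\<^sup>+\<theta>\<in>{0..2 * pi}. ennreal (sqrt (norm (S ins \<theta>))) \<partial>lborel)
       + (\<integral>\<^sup>+\<theta>\<in>{0..2 * pi}. ennreal (sqrt (norm (S outs \<theta>))) \<partial>lborel)
       + ennreal (sqrt (108 * B)) * ennreal (2 * pi))"
    by (simp add: nn_integral_cmult nn_integral_add nn_integral_cmult_indicator)
  also have "\<dots> \<le> 2 * (ennreal (2 * pi * (2 * sqrt (8 * B))) + ennreal (2 * pi * (2 * sqrt (8 * B)))
       + ennreal (sqrt (108 * B)) * ennreal (2 * pi))"
    by (intro mult_left_mono add_mono I_in I_out) auto
  also have "\<dots> = ennreal (2 * pi * (2 * (4 * sqrt (8 * B) + sqrt (108 * B))))"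
  proof -
    define p where "p = 2 * pi * (2 * sqrt (8 * B))"
    define q where "q = sqrt (108 * B)"
    have nonneg: "0 \<le> p" "0 \<le> q" using B by (auto simp: p_def q_def)
    have "2 * (ennreal p + ennreal p + ennreal q * ennreal (2 * pi))
        = ennreal 2 * (ennreal p + ennreal p + ennreal q * ennreal (2 * pi))" by simp
    also have "\<dots> = ennreal (2 * (p + p + q * (2 * pi)))"
      using nonneg by (simp only: ennreal_mult ennreal_plus mult_nonneg_nonneg add_nonneg_nonneg
          pi_ge_zero zero_le_numeral)
    also have "2 * (p + p + q * (2 * pi)) = 2 * pi * (2 * (4 * sqrt (8 * B) + sqrt (108 * B)))"
      by (simp add: p_def q_def algebra_simps)
    finally show ?thesis unfolding p_def q_def .
  qed
  finally have "proximity r (\<lambda>z. deriv f z / f z) \<le>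
      ennreal (1 / (2 * pi)) * ennreal (2 * pi * (2 * (4 * sqrt (8 * B) + sqrt (108 * B))))"
    unfolding proximity_def by (intro mult_left_mono) auto
  also have "\<dots> = ennreal (2 * (4 * sqrt (8 * B) + sqrt (108 * B)))"
    using B by (subst ennreal_mult[symmetric]) auto
  finally show ?thesis .
qed

lemma finite_log_measure_zero_moduli:
  assumes f: "f holomorphic_on UNIV" "f 0 = 1"
  shows "finite_log_measure (norm ` {z. f z = 0})"
proof -
  have "countable {z\<in>UNIV. f z = 0}"
  proof (cases "f constant_on UNIV")
    case True
    then have "f z = 1" for z using f(2) by (auto simp: constant_on_def)
    then show ?thesis by simp
  next
    case False
    then show ?thesis using f by (intro holomorphic_countable_zeros) auto
  qed
  then have "countable (norm ` {z. f z = 0})" by simp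
  then have null: "norm ` {z. f z = 0} \<in> null_sets lebesgue"
    by (meson countable_imp_null_set_lborel null_sets_completionI)
  then have "(\<integral>\<^sup>+t\<in>norm ` {z. f z = 0}. ennreal (1 / t) \<partial>lebesgue) = 0"
    by (rule nn_integral_null_set)
  then show ?thesis using null by (auto simp: finite_log_measure_def)
qed

section \<open>The Kummer function\<close>

lemma pochhammer_ratio_bound:
  fixes \<alpha> \<gamma> :: complex
  assumes "\<gamma> \<notin> \<int>\<^sub>\<le>\<^sub>0"
  obtains B where "0 < B" "\<And>n. norm (pochhammer \<alpha> n / pochhammer \<gamma> n) \<le> B ^ n"
proof -
  have ne: "\<gamma> + of_nat k \<noteq> 0" for k
    using assms plus_of_nat_eq_0_imp[of \<gamma> k] by auto
  have "(\<lambda>k. (\<alpha> + of_nat k) / (\<gamma> + of_nat k)) \<longlonglongrightarrow> 1"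
  proof -
    have "(\<lambda>k. 1 + (\<alpha> - \<gamma>) / (\<gamma> + of_nat k)) \<longlonglongrightarrow> 1 + 0"
      by (intro tendsto_add tendsto_const tendsto_divide_0[OF tendsto_const]
          tendsto_add_filterlim_at_infinity[OF tendsto_const] tendsto_of_nat)
    moreover have "1 + (\<alpha> - \<gamma>) / (\<gamma> + of_nat k) = (\<alpha> + of_nat k) / (\<gamma> + of_nat k)" for k
      using ne[of k] by (simp add: field_simps)
    ultimately show ?thesis by simp
  qed
  then have "Bseq (\<lambda>k. (\<alpha> + of_nat k) / (\<gamma> + of_nat k))"
    by (intro convergent_imp_Bseq) (auto simp: convergent_def)
  then obtain B where B: "0 < B" "\<And>k. norm ((\<alpha> + of_nat k) / (\<gamma> + of_nat k)) \<le> B"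
    by (auto elim: BseqE)
  have "norm (pochhammer \<alpha> n / pochhammer \<gamma> n) \<le> B ^ n" for n
  proof (induction n)
    case (Suc n)
    have "pochhammer \<alpha> (Suc n) / pochhammer \<gamma> (Suc n)
       = (\<alpha> + of_nat n) / (\<gamma> + of_nat n) * (pochhammer \<alpha> n / pochhammer \<gamma> n)"
      by (simp add: pochhammer_Suc mult_ac)
    then have "norm (pochhammer \<alpha> (Suc n) / pochhammer \<gamma> (Suc n))
       = norm ((\<alpha> + of_nat n) / (\<gamma> + of_nat n)) * norm (pochhammer \<alpha> n / pochhammer \<gamma> n)"
      by (simp only: norm_mult)
    also have "\<dots> \<le> B * B ^ n"
      using B(1) by (intro mult_mono B(2) Suc.IH) auto
    finally show ?case by simp
  qed simp
  with B(1) show ?thesis by (rule that)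
qed

lemma kummer_exponential_type:
  fixes \<alpha> \<gamma> :: complex
  assumes "\<gamma> \<notin> \<int>\<^sub>\<le>\<^sub>0"
  obtains B where "0 < B" "\<And>z. norm (kummer \<alpha> \<gamma> z) \<le> exp (B * norm z)"
    "kummer \<alpha> \<gamma> holomorphic_on UNIV" "kummer \<alpha> \<gamma> 0 = 1"
proof -
  obtain B where B: "0 < B" "\<And>n. norm (pochhammer \<alpha> n / pochhammer \<gamma> n) \<le> B ^ n"
    using pochhammer_ratio_bound[OF assms] by blast
  define c where "c = (\<lambda>n. pochhammer \<alpha> n / (fact n * pochhammer \<gamma> n))"
  have k: "kummer \<alpha> \<gamma> z = (\<Sum>n. c n * z ^ n)" for z by (simp add: kummer_def c_def)
  have le: "norm (c n * z ^ n) \<le> (B * norm z) ^ n /\<^sub>R fact n" for n z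
  proof -
    have "norm (c n * z ^ n) = norm (pochhammer \<alpha> n / pochhammer \<gamma> n) * (norm z ^ n / fact n)"
      by (simp add: c_def norm_mult norm_divide norm_power)
    also have "\<dots> \<le> B ^ n * (norm z ^ n / fact n)" by (intro mult_right_mono B) auto
    finally show ?thesis by (simp add: power_mult_distrib field_simps)
  qed
  have sm: "summable (\<lambda>n. c n * z ^ n)" for z
    by (rule summable_comparison_test'[OF summable_exp_generic le])
  show ?thesis
  proof (rule that[OF B(1)])
    show "norm (kummer \<alpha> \<gamma> z) \<le> exp (B * norm z)" for z
      unfolding k exp_def by (rule norm_suminf_le[OF le summable_exp_generic])
    have "kummer \<alpha> \<gamma> field_differentiable at z" for z
      using termdiffs_strong_converges_everywhere[OF sm, of z]
      by (auto simp: field_differentiable_def k[abs_def])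
    then show "kummer \<alpha> \<gamma> holomorphic_on UNIV"
      by (auto simp: holomorphic_on_def)
    show "kummer \<alpha> \<gamma> 0 = 1" unfolding k powser_zero by (simp add: c_def)
  qed
qed

theorem theorem3p4:
  fixes \<alpha> \<gamma> :: complex
  assumes "\<gamma> \<notin> \<int>\<^sub>\<le>\<^sub>0"
  shows "\<exists>E. E \<subseteq> {0<..} \<and> finite_log_measure E \<and>
    (\<exists>C::real. \<forall>\<^sub>F r in at_top. r \<notin> E \<longrightarrow>
       proximity r (\<lambda>z. deriv (kummer \<alpha> \<gamma>) z / kummer \<alpha> \<gamma> z) \<le> ennreal C)"
proof -
  obtain B where B: "0 < B" "\<And>z. norm (kummer \<alpha> \<gamma> z) \<le> exp (B * norm z)"
    and hol: "kummer \<alpha> \<gamma> holomorphic_on UNIV" and k0: "kummer \<alpha> \<gamma> 0 = 1"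
    using kummer_exponential_type[OF assms] by blast
  define E where "E = norm ` {z. kummer \<alpha> \<gamma> z = 0}"
  have "E \<subseteq> {0<..}" using k0 by (auto simp: E_def)
  moreover have "finite_log_measure E"
    unfolding E_def by (rule finite_log_measure_zero_moduli[OF hol k0])
  moreover have "\<forall>\<^sub>F r in at_top. r \<notin> E \<longrightarrow> proximity r (\<lambda>z. deriv (kummer \<alpha> \<gamma>) z / kummer \<alpha> \<gamma> z)
      \<le> ennreal (2 * (4 * sqrt (8 * B) + sqrt (108 * B)))"
    using eventually_gt_at_top[of 0]
  proof eventually_elim
    case (elim r)
    show ?case
      by (intro impI proximity_log_deriv_exponential_type[OF hol k0 B elim]) (auto simp: E_def)
  qed
  ultimately show ?thesis by blast
qed

end
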